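(* Suppose that the level set $\mathcal{X}=\{x\in\mathbb{R}^n:F(x)\le F(x^{(0)})\}$ is compact. Then, for the algorithm MPGA (with any choice of the indices $i$ at the iterations), the following statements hold: (i) At every iteration in which it is entered, Step 2-X terminates after finitely many trials at some $\alpha\ge\underline{\alpha}_{\star}$, where $\underline{\alpha}_{\star}:=\gamma\min\{\underline{\alpha},\underline{\alpha}_{\mathcal{S},\sigma}\}$. In other words, $\alpha_{(t)}\ge\underline{\alpha}_{\star}$ for all $t\in\mathbb{N}$. (ii) The sequence $\{(x^{(t)},y^{(t)}):t\in\mathbb{N}\}$ generated by MPGA is contained in $\mathcal{S}$, and for every $t\in\mathbb{N}$, $$\zeta(x^{(t+1)})+C_0\left(\|x^{(t+1)}-x^{(t)}\|_2^2+Q_{(l(t))}\|y^{(t+1)}-y^{(t)}\|_2^2\right)\le Q_{(l(t))}\,\eta(x^{(t+1)},y^{(t+1)}),$$ $$Q(x^{(t+1)},y^{(t+1)})\le Q_{(l(t+1))}\le Q_{(l(t))}\le F(x^{(0)}),$$ where $C_0:=\min\{\sigma/2,1/\overline{\alpha}\}>0$.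
   Context: Setting. $f,g,h:\mathbb{R}^n\to(-\infty,+\infty]$ are proper lower semicontinuous functions, $\Omega:=\{x\in\mathbb{R}^n: g(x)\neq 0\}$ is nonempty, and $f$ is block-separable: $f(x)=\sum_{i=1}^N f_i(x_i)$, where the subvectors $x_i\in\mathbb{R}^{n_i}$ form a partition of the components of $x$ and each $f_i:\mathbb{R}^{n_i}\to(-\infty,+\infty]$ is proper lower semicontinuous. Standing assumptions: (a) $f$ is continuous on $\mathrm{dom}(f)$ and each $f_i$ is bounded below; (b) $h$ is locally Lipschitz differentiable on $\Omega$, i.e. every $x\in\Omega$ has a neighborhood $\mathcal{B}(x)$ and a constant $L_x$ with $\|\nabla h(u)-\nabla h(v)\|_2\le L_x\|u-v\|_2$ for all $u,v\in\mathcal{B}(x)\cap\Omega$; (c) $g$ is convex, real-valued and nonnegative on $\mathbb{R}^n$; (d) $f+h\ge 0$ on $\mathrm{dom}(f)$. Notation. $\mathrm{dom}(\varphi)=\{x:\varphi(x)<+\infty\}$; $g^*(y)=\sup_x\{\langle x,y\rangle-g(x)\}$; $\partial g$ is the convex subdifferential; $\nabla_ih$ is the partial gradient with respect to $x_i$; $\zeta(x):=f(x)+h(x)$; $\eta(x,y):=\langle x,y\rangle-g^*(y)$. $F(x)=\zeta(x)/g(x)$ if $x\in\Omega\cap\mathrm{dom}(f)$ and $F(x)=+\infty$ otherwise. $Q(x,y)=\zeta(x)/\eta(x,y)$ if $(x,y)\in\mathrm{dom}(f)\times\mathrm{dom}(g^* )$ and $\eta(x,y)>0$, and $Q(x,y)=+\infty$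 otherwise. $\mathrm{prox}_{\varphi}(x)=\arg\min_z\{\varphi(z)+\frac12\|z-x\|_2^2\}$ (possibly set-valued). $[s]_+=\max\{0,s\}$. Algorithm MPGA. Input: $x^{(0)}\in\mathrm{dom}(F)$, $y^{(0)}\in\partial g(x^{(0)})$, reals $0<\underline{\alpha}\le\overline{\alpha}$, $\sigma>0$, $0<\gamma<1$, an integer $M\ge0$. For $t=0,1,2,\dots$: Step 1. Let $Q_{(t)}=Q(x^{(t)},y^{(t)})$ and $l(t)=\max\{j\le t:Q_{(j)}=\max\{Q_{(s)}:[t-M]_+\le s\le t\}\}$. Step 2. Pick $i\in\{0,1,\dots,N\}$ and an initial $\alpha\in[\underline{\alpha},\overline{\alpha}]$. Step 2-Y (if $i=0$): set $x^{(t+1)}=x^{(t)}$, $y^{(t+1)}=\mathrm{prox}_{\alpha g^*}(y^{(t)}+\alpha x^{(t)})$. Step 2-X (if $i\ge1$): compute $x_i^{(t)}(\alpha)\in\mathrm{prox}_{\alpha f_i}\big(x_i^{(t)}-\alpha\nabla_ih(x^{(t)})+\alpha Q_{(t)}y_i^{(t)}\big)$ and let $x^{(t),i}(\alpha)$ be $x^{(t)}$ with its $i$-th block replaced by $x_i^{(t)}(\alpha)$. If $\zeta(x^{(t),i}(\alpha))+\frac{\sigma}{2}\|x^{(t),i}(\alpha)-x^{(t)}\|_2^2\le Q_{(l(t))}\,\eta(x^{(t),i}(\alpha),y^{(t)})$, set $(x^{(t+1)},y^{(t+1)})=(x^{(t),i}(\alpha),y^{(t)})$; otherwise replace $\alpha$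 by $\alpha\gamma$ and repeat Step 2-X. Step 3. Record $i_{(t)}=i$ and $\alpha_{(t)}=\alpha$ (the final value of $\alpha$); go to the next $t$. Sets and constants. Let $\overline{g}_{\mathcal{X}}>0$ be a constant with $g\le\overline{g}_{\mathcal{X}}$ on $\mathcal{X}$; $\mathcal{X}_{\underline{\alpha}}:=\{z:\mathrm{dist}^2(z,\mathcal{X})\le\overline{g}_{\mathcal{X}}/\underline{\alpha}\}$; $\mathcal{Y}:=\bigcup_{z\in\mathcal{X}_{\underline{\alpha}}}\partial g(z)$; $\mathcal{S}:=\{(x,y)\in\mathcal{X}\times\mathcal{Y}:\eta(x,y)>0\}$. The number $\underline{\alpha}_{\mathcal{S},\sigma}>0$ is a constant (one exists when $\mathcal{X}$ is compact) such that for all $(x,y)\in\mathcal{S}$ with $Q(x,y)\le F(x^{(0)})$, all $\alpha\in(0,\underline{\alpha}_{\mathcal{S},\sigma})$, all $i\in\{1,\dots,N\}$, all $c\in[Q(x,y),+\infty)$ and all $x_i^+(\alpha)\in\mathrm{prox}_{\alpha f_i}(x_i-\alpha\nabla_ih(x)+\alpha Q(x,y)y_i)$, the vector $x^{+,i}(\alpha)$ obtained from $x$ by replacing its $i$-th block by $x_i^+(\alpha)$ satisfies $\zeta(x^{+,i}(\alpha))+\frac{\sigma}{2}\|x^{+,i}(\alpha)-x\|_2^2\le c\,\eta(x^{+,i}(\alpha),y)$. *)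

theory Defs
  imports "HOL-Analysis.Analysis"
begin

section \<open>Extended-real-valued functions\<close>

text \<open>The notions below are relative to a set \<open>S\<close>, so that they apply both to functions on the
  whole space (\<open>S = UNIV\<close>) and to functions on a coordinate subspace.\<close>

definition proper_on :: "'a set \<Rightarrow> ('a \<Rightarrow> ereal) \<Rightarrow> bool" where
  "proper_on S \<phi> \<longleftrightarrow> (\<forall>x\<in>S. \<phi> x \<noteq> -\<infinity>) \<and> (\<exists>x\<in>S. \<phi> x < \<infinity>)"

definition lsc_on :: "'a::topological_space set \<Rightarrow> ('a \<Rightarrow> ereal) \<Rightarrow> bool" where
  "lsc_on S \<phi> \<longleftrightarrow> (\<forall>x\<in>S. \<phi> x \<le> Liminf (at x within S) \<phi>)"

definition dom :: "('a \<Rightarrow> ereal) \<Rightarrow> 'a set" where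
  "dom \<phi> = {x. \<phi> x < \<infinity>}"

definition conjugate :: "('a::real_inner \<Rightarrow> real) \<Rightarrow> 'a \<Rightarrow> ereal" where
  "conjugate g y = (SUP x. ereal (x \<bullet> y - g x))"

definition subdifferential :: "('a::real_inner \<Rightarrow> real) \<Rightarrow> 'a \<Rightarrow> 'a set" where
  "subdifferential g x = {v. \<forall>z. g z \<ge> g x + v \<bullet> (z - x)}"

definition prox_on :: "'a::real_inner set \<Rightarrow> ('a \<Rightarrow> ereal) \<Rightarrow> 'a \<Rightarrow> 'a set" where
  "prox_on S \<phi> x =
     {p. is_arg_min (\<lambda>z. \<phi> z + ereal (1/2 * (norm (z - x))\<^sup>2)) (\<lambda>z. z \<in> S) p}"

text \<open>Differentiability of an extended-real-valued function is that of its real part. It is only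
  used on an open set on which the function is finite.\<close>

definition grad :: "('a::real_inner \<Rightarrow> ereal) \<Rightarrow> 'a \<Rightarrow> 'a" where
  "grad \<phi> x = (THE D. GDERIV (\<lambda>z. real_of_ereal (\<phi> z)) x :> D)"

definition loc_Lipschitz_differentiable_on ::
    "'a::real_inner set \<Rightarrow> ('a \<Rightarrow> ereal) \<Rightarrow> bool" where
  "loc_Lipschitz_differentiable_on S \<phi> \<longleftrightarrow>
     (\<forall>x\<in>S. \<bar>\<phi> x\<bar> \<noteq> \<infinity> \<and> (\<exists>D. GDERIV (\<lambda>z. real_of_ereal (\<phi> z)) x :> D)) \<and>
     (\<forall>x\<in>S. \<exists>B L. open B \<and> x \<in> B \<and>
        (\<forall>u\<in>B \<inter> S. \<forall>v\<in>B \<inter> S. norm (grad \<phi> u - grad \<phi> v) \<le> L * norm (u - v)))"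


section \<open>Blocks of components\<close>

text \<open>A partition of the components into \<open>N\<close> blocks is a map \<open>blk\<close> from the index type onto
  \<open>{1..N}\<close>. The space of the \<open>i\<close>-th subvectors is represented, isometrically, by the coordinate
  subspace \<open>block_space blk i\<close>, and the subvector \<open>x\<^sub>i\<close> by the projection \<open>block blk i x\<close> of \<open>x\<close>.
  A function of the \<open>i\<close>-th subvector is a function whose values outside this subspace are
  irrelevant.\<close>

definition block_space :: "('n \<Rightarrow> nat) \<Rightarrow> nat \<Rightarrow> (real^'n) set" where
  "block_space blk i = {z. \<forall>j. blk j \<noteq> i \<longrightarrow> z $ j = 0}"

definition block :: "('n \<Rightarrow> nat) \<Rightarrow> nat \<Rightarrow> real^'n \<Rightarrow> real^'n" where
  "block blk i x = (\<chi> j. if blk j = i then x $ j else 0)"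

definition replace_block :: "('n \<Rightarrow> nat) \<Rightarrow> nat \<Rightarrow> real^'n \<Rightarrow> real^'n \<Rightarrow> real^'n" where
  "replace_block blk i x p = (\<chi> j. if blk j = i then p $ j else x $ j)"


section \<open>The fractional program\<close>

definition zeta :: "('a \<Rightarrow> ereal) \<Rightarrow> ('a \<Rightarrow> ereal) \<Rightarrow> 'a \<Rightarrow> ereal" where
  "zeta f h x = f x + h x"

definition eta :: "('a::real_inner \<Rightarrow> real) \<Rightarrow> 'a \<Rightarrow> 'a \<Rightarrow> ereal" where
  "eta g x y = ereal (x \<bullet> y) - conjugate g y"

definition Omega :: "('a \<Rightarrow> real) \<Rightarrow> 'a set" where
  "Omega g = {x. g x \<noteq> 0}"

definition F_fun :: "('a \<Rightarrow> ereal) \<Rightarrow> ('a \<Rightarrow> real) \<Rightarrow> ('a \<Rightarrow> ereal) \<Rightarrow> 'a \<Rightarrow> ereal" where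
  "F_fun f g h x = (if x \<in> Omega g \<inter> dom f then zeta f h x / ereal (g x) else \<infinity>)"

definition Q_fun ::
    "('a::real_inner \<Rightarrow> ereal) \<Rightarrow> ('a \<Rightarrow> real) \<Rightarrow> ('a \<Rightarrow> ereal) \<Rightarrow> 'a \<Rightarrow> 'a \<Rightarrow> ereal" where
  "Q_fun f g h x y =
     (if x \<in> dom f \<and> y \<in> dom (conjugate g) \<and> eta g x y > 0
      then zeta f h x / eta g x y else \<infinity>)"

definition X_set ::
    "('a \<Rightarrow> ereal) \<Rightarrow> ('a \<Rightarrow> real) \<Rightarrow> ('a \<Rightarrow> ereal) \<Rightarrow> 'a \<Rightarrow> 'a set" where
  "X_set f g h x0 = {x. F_fun f g h x \<le> F_fun f g h x0}"

definition Y_set ::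
    "('a::real_inner \<Rightarrow> real) \<Rightarrow> 'a set \<Rightarrow> real \<Rightarrow> real \<Rightarrow> 'a set" where
  "Y_set g X gbar \<alpha>lo = (\<Union>z \<in> {z. (infdist z X)\<^sup>2 \<le> gbar / \<alpha>lo}. subdifferential g z)"

definition S_set ::
    "('a::real_inner \<Rightarrow> ereal) \<Rightarrow> ('a \<Rightarrow> real) \<Rightarrow> ('a \<Rightarrow> ereal) \<Rightarrow> 'a \<Rightarrow> real \<Rightarrow> real
      \<Rightarrow> ('a \<times> 'a) set" where
  "S_set f g h x0 gbar \<alpha>lo =
     {(x, y). x \<in> X_set f g h x0 \<and> y \<in> Y_set g (X_set f g h x0) gbar \<alpha>lo \<and> eta g x y > 0}"


section \<open>The algorithm MPGA\<close>

text \<open>The possible trial blocks of Step 2-X at \<open>(x, y)\<close> with step size \<open>\<alpha>\<close>. The partial gradient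
  with respect to the \<open>i\<close>-th block is the \<open>i\<close>-th block of the gradient. The value of \<open>Q\<close> is finite
  at all points at which this definition is used.\<close>

definition trial_blocks ::
    "('n::finite \<Rightarrow> nat) \<Rightarrow> (nat \<Rightarrow> real^'n \<Rightarrow> ereal) \<Rightarrow> (real^'n \<Rightarrow> ereal) \<Rightarrow> (real^'n \<Rightarrow> real)
      \<Rightarrow> (real^'n \<Rightarrow> ereal) \<Rightarrow> real^'n \<Rightarrow> real^'n \<Rightarrow> nat \<Rightarrow> real \<Rightarrow> (real^'n) set" where
  "trial_blocks blk fs f g h x y i \<alpha> =
     prox_on (block_space blk i) (\<lambda>z. ereal \<alpha> * fs i z)
       (block blk i x - \<alpha> *\<^sub>R block blk i (grad h x)
          + (\<alpha> * real_of_ereal (Q_fun f g h x y)) *\<^sub>R block blk i y)"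

text \<open>The line-search test of Step 2-X, for moving from \<open>x\<close> to \<open>x'\<close>, with the number \<open>c\<close> in place
  of the reference value.\<close>

definition accepted ::
    "('a::real_inner \<Rightarrow> ereal) \<Rightarrow> ('a \<Rightarrow> real) \<Rightarrow> ('a \<Rightarrow> ereal) \<Rightarrow> real \<Rightarrow> ereal
      \<Rightarrow> 'a \<Rightarrow> 'a \<Rightarrow> 'a \<Rightarrow> bool" where
  "accepted f g h \<sigma> c x y x' \<longleftrightarrow>
     zeta f h x' + ereal (\<sigma> / 2 * (norm (x' - x))\<^sup>2) \<le> c * eta g x' y"

text \<open>The index \<open>l(t)\<close> for the sequence \<open>q\<close> of values \<open>Q\<^sub>(\<^sub>t\<^sub>)\<close>; the truncated subtraction
  \<open>t - M\<close> is the positive part.\<close>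

definition last_max_index :: "nat \<Rightarrow> (nat \<Rightarrow> ereal) \<Rightarrow> nat \<Rightarrow> nat" where
  "last_max_index M q t = Max {j. j \<le> t \<and> q j = Max (q ` {t - M..t})}"

definition Q_ref ::
    "('a::real_inner \<Rightarrow> ereal) \<Rightarrow> ('a \<Rightarrow> real) \<Rightarrow> ('a \<Rightarrow> ereal) \<Rightarrow> nat
      \<Rightarrow> (nat \<Rightarrow> 'a) \<Rightarrow> (nat \<Rightarrow> 'a) \<Rightarrow> nat \<Rightarrow> ereal" where
  "Q_ref f g h M xs ys t =
     (let q = (\<lambda>s. Q_fun f g h (xs s) (ys s)) in q (last_max_index M q t))"

definition step_Y ::
    "('a::real_inner \<Rightarrow> real) \<Rightarrow> real \<Rightarrow> 'a \<Rightarrow> 'a \<Rightarrow> 'a \<Rightarrow> 'a \<Rightarrow> bool" where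
  "step_Y g \<alpha> x y x' y' \<longleftrightarrow>
     x' = x \<and> y' \<in> prox_on UNIV (\<lambda>v. ereal \<alpha> * conjugate g v) (y + \<alpha> *\<^sub>R x)"

text \<open>The backtracking loop of Step 2-X started with the step size \<open>\<alpha>0\<close>, where \<open>p j\<close> is the block
  chosen in trial number \<open>j\<close> (counted from 0): it stops successfully at trial number \<open>k\<close>.\<close>

definition stops_at ::
    "('n::finite \<Rightarrow> nat) \<Rightarrow> (real^'n \<Rightarrow> ereal) \<Rightarrow> (real^'n \<Rightarrow> real) \<Rightarrow> (real^'n \<Rightarrow> ereal) \<Rightarrow> real
      \<Rightarrow> ereal \<Rightarrow> real^'n \<Rightarrow> real^'n \<Rightarrow> nat \<Rightarrow> (nat \<Rightarrow> real^'n) \<Rightarrow> nat \<Rightarrow> bool" where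
  "stops_at blk f g h \<sigma> c x y i p k \<longleftrightarrow>
     accepted f g h \<sigma> c x y (replace_block blk i x (p k)) \<and>
     (\<forall>j<k. \<not> accepted f g h \<sigma> c x y (replace_block blk i x (p j)))"

definition step_X ::
    "('n::finite \<Rightarrow> nat) \<Rightarrow> (nat \<Rightarrow> real^'n \<Rightarrow> ereal) \<Rightarrow> (real^'n \<Rightarrow> ereal) \<Rightarrow> (real^'n \<Rightarrow> real)
      \<Rightarrow> (real^'n \<Rightarrow> ereal) \<Rightarrow> real \<Rightarrow> real \<Rightarrow> ereal \<Rightarrow> nat \<Rightarrow> real \<Rightarrow> real^'n \<Rightarrow> real^'n
      \<Rightarrow> real \<Rightarrow> real^'n \<Rightarrow> real^'n \<Rightarrow> bool" where
  "step_X blk fs f g h \<sigma> \<gamma> c i \<alpha>0 x y \<alpha> x' y' \<longleftrightarrow>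
     (\<exists>p k. (\<forall>j\<le>k. p j \<in> trial_blocks blk fs f g h x y i (\<alpha>0 * \<gamma> ^ j)) \<and>
            stops_at blk f g h \<sigma> c x y i p k \<and>
            \<alpha> = \<alpha>0 * \<gamma> ^ k \<and> x' = replace_block blk i x (p k) \<and> y' = y)"

text \<open>Iterations \<open>0, \<dots>, T - 1\<close> of MPGA have been completed, producing the iterates
  \<open>(xs t, ys t)\<close> for \<open>t \<le> T\<close> and recording the indices \<open>ind t\<close> and final step sizes \<open>al t\<close> for
  \<open>t < T\<close>. All other values of the sequences are irrelevant.\<close>

definition mpga_run ::
    "('n::finite \<Rightarrow> nat) \<Rightarrow> nat \<Rightarrow> (nat \<Rightarrow> real^'n \<Rightarrow> ereal) \<Rightarrow> (real^'n \<Rightarrow> ereal)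
      \<Rightarrow> (real^'n \<Rightarrow> real) \<Rightarrow> (real^'n \<Rightarrow> ereal) \<Rightarrow> real \<Rightarrow> real \<Rightarrow> real \<Rightarrow> real \<Rightarrow> nat
      \<Rightarrow> real^'n \<Rightarrow> real^'n \<Rightarrow> nat
      \<Rightarrow> (nat \<Rightarrow> real^'n) \<Rightarrow> (nat \<Rightarrow> real^'n) \<Rightarrow> (nat \<Rightarrow> nat) \<Rightarrow> (nat \<Rightarrow> real) \<Rightarrow> bool" where
  "mpga_run blk N fs f g h \<alpha>lo \<alpha>hi \<sigma> \<gamma> M x0 y0 T xs ys ind al \<longleftrightarrow>
     xs 0 = x0 \<and> ys 0 = y0 \<and>
     (\<forall>t<T. ind t \<in> {0..N} \<and>
        (\<exists>\<alpha>0\<in>{\<alpha>lo..\<alpha>hi}.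
           if ind t = 0
           then al t = \<alpha>0 \<and> step_Y g \<alpha>0 (xs t) (ys t) (xs (Suc t)) (ys (Suc t))
           else step_X blk fs f g h \<sigma> \<gamma> (Q_ref f g h M xs ys t) (ind t) \<alpha>0
                  (xs t) (ys t) (al t) (xs (Suc t)) (ys (Suc t))))"

end

theory Submission
  imports Defs
begin

text \<open>Membership in \<open>\<S>\<close> together with \<open>Q\<^sub>(\<^sub>l\<^sub>(\<^sub>t\<^sub>)\<^sub>) \<le> F(x\<^sup>0)\<close> is an invariant. In Step 2-Y, optimality of
  \<open>y'\<close> for the prox problem means \<open>y' \<in> \<partial>g(w)\<close> with \<open>w = x + (y - y') / \<alpha>\<close>, and gives
  \<open>\<eta>(x, y) + \<parallel>y' - y\<parallel>\<^sup>2 / \<alpha> \<le> \<eta>(x, y') \<le> g(x)\<close>. This yields the decrease of \<open>Q\<close>, and also bounds the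
  distance of \<open>w\<close> from \<open>\<X>\<close>, so that \<open>y' \<in> \<Y>\<close>. In Step 2-X, the invariant makes the assumption on
  \<open>\<alpha>S\<close> applicable, so every rejected step size is at least \<open>\<alpha>S\<close>, and the acceptance test together with
  \<open>F \<le> Q\<close> preserves the invariant.\<close>

section \<open>Convex conjugates and subgradients\<close>

lemma conjugate_ge: "ereal (x \<bullet> y - g x) \<le> conjugate g y"
  unfolding conjugate_def by (rule SUP_upper) simp

lemma conjugate_not_MInf [simp]: "conjugate g y \<noteq> -\<infinity>"
  using conjugate_ge[of 0 y g] by auto

text \<open>This is the Fenchel-Young inequality. It bounds the denominator of \<open>Q\<close> by
  that of \<open>F\<close>, and it also excludes the value \<infinity> for
  \<open>eta\<close>.\<close>

lemma eta_le: "eta g x y \<le> ereal (g x)"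
proof (cases "conjugate g y")
  case (real k)
  then show ?thesis using conjugate_ge[of x y g] by (simp add: eta_def)
qed (auto simp: eta_def)

text \<open>The equality case of Fenchel-Young: a subgradient at \<open>x\<close> makes
  \<open>x\<close> a maximiser in the supremum. In particular the conjugate is finite at every
  subgradient.\<close>

lemma conjugate_subgradient:
  assumes "v \<in> subdifferential g x"
  shows "conjugate g v = ereal (x \<bullet> v - g x)"
proof (rule antisym)
  show "conjugate g v \<le> ereal (x \<bullet> v - g x)"
    unfolding conjugate_def
  proof (rule SUP_least)
    fix z
    have "g z \<ge> g x + v \<bullet> (z - x)"
      using assms by (simp add: subdifferential_def)
    then show "ereal (z \<bullet> v - g z) \<le> ereal (x \<bullet> v - g x)"
      by (simp add: inner_diff_right inner_commute)
  qed
qed (rule conjugate_ge)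

lemma subgradientI_conjugate:
  assumes "conjugate g v \<le> ereal (x \<bullet> v - g x)"
  shows "v \<in> subdifferential g x"
proof -
  have "z \<bullet> v - g z \<le> x \<bullet> v - g x" for z
    using order_trans[OF conjugate_ge[of z v g] assms] by simp
  then show ?thesis
    by (simp add: subdifferential_def inner_diff_right inner_commute algebra_simps)
qed

text \<open>The vertical ray strictly below the graph at \<open>w\<close> is separated from the
  epigraph. As \<open>g\<close> is finite everywhere, the separating hyperplane cannot be vertical,
  and its slope is a subgradient.\<close>

lemma subdifferential_nonempty:
  fixes g :: "'a::euclidean_space \<Rightarrow> real"
  assumes "convex_on UNIV g"
  shows "subdifferential g w \<noteq> {}"
proof -
  let ?ray = "{w} \<times> {..<g w}"
  have "convex (epigraph UNIV g)" using assms by (rule convex_epigraphI)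
  moreover have "convex ?ray" by (intro convex_Times) auto
  moreover have "?ray \<noteq> {}" by (auto intro: lt_ex)
  moreover have "(w, g w) \<in> epigraph UNIV g" by (simp add: mem_epigraph)
  moreover have "?ray \<inter> epigraph UNIV g = {}" by (auto simp: mem_epigraph)
  ultimately obtain a :: "'a \<times> real" and \<beta> where a: "a \<noteq> 0" "\<And>p. p \<in> ?ray \<Longrightarrow> a \<bullet> p \<le> \<beta>"
      "\<And>p. p \<in> epigraph UNIV g \<Longrightarrow> a \<bullet> p \<ge> \<beta>"
    using separating_hyperplane_sets[of ?ray "epigraph UNIV g"] by blast
  obtain u s where us: "a = (u, s)" by fastforce
  have sep: "u \<bullet> w + s * r \<le> u \<bullet> x + s * g x" if "r < g w" for r x
    using a(2)[of "(w, r)"] a(3)[of "(x, g x)"] that by (simp add: us mem_epigraph)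
  have "s \<ge> 0" using sep[of "g w - 1" w] by (simp add: algebra_simps)
  have "s \<noteq> 0"
  proof
    assume "s = 0"
    \<comment> \<open>With \<open>s = 0\<close> the functional \<open>u\<close> would attain its
      minimum over the whole space at \<open>w\<close>; moving in the direction \<open>- u\<close>
      shows that it vanishes.\<close>
    then have "u \<bullet> w \<le> u \<bullet> (w - u)" using sep[of "g w - 1" "w - u"] by simp
    then have "u \<bullet> u \<le> 0" by (simp add: inner_diff_right)
    then have "u = 0" using inner_eq_zero_iff[of u] inner_ge_zero[of u] by linarith
    then show False using a(1) us \<open>s = 0\<close> by (simp add: zero_prod_def)
  qed
  with \<open>s \<ge> 0\<close> have "s > 0" by simp
  have "g x \<ge> g w + (- (u /\<^sub>R s)) \<bullet> (x - w)" for x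
  \<comment> \<open>The point \<open>(w, g w)\<close> itself is not on the ray, so the bound is
    obtained at height \<open>g w - e\<close> for every \<open>e > 0\<close>.\<close>
  proof (rule field_le_epsilon)
    fix e :: real assume "e > 0"
    with sep[of "g w - e" x] have "u \<bullet> w + s * (g w - e) \<le> u \<bullet> x + s * g x" by simp
    then show "g w + (- (u /\<^sub>R s)) \<bullet> (x - w) \<le> g x + e"
      using \<open>s > 0\<close> by (simp add: inner_diff_right field_simps)
  qed
  then show ?thesis unfolding subdifferential_def by blast
qed

text \<open>Each \<open>x\<close> contributes an affine function of the dual variable, and their
  supremum lies below its chords. The segment form suits the comparison along a line through a prox
  point.\<close>

lemma conjugate_convex:
  assumes "conjugate g y = ereal a" "conjugate g v = ereal b" "0 \<le> s" "s \<le> 1"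
  shows "conjugate g (y + s *\<^sub>R (v - y)) \<le> ereal (a + s * (b - a))"
  unfolding conjugate_def
proof (rule SUP_least)
  fix x
  have "x \<bullet> y - g x \<le> a" "x \<bullet> v - g x \<le> b"
    using conjugate_ge[of x y g] conjugate_ge[of x v g] assms by auto
  then have "(1 - s) * (x \<bullet> y - g x) + s * (x \<bullet> v - g x) \<le> (1 - s) * a + s * b"
    using assms by (intro add_mono mult_left_mono) auto
  then show "ereal (x \<bullet> (y + s *\<^sub>R (v - y)) - g x) \<le> ereal (a + s * (b - a))"
    by (simp add: inner_add_right inner_diff_right algebra_simps)
qed

section \<open>Proximity operators\<close>

text \<open>The optimality condition gives \<open>(u - p) / \<alpha> \<in> \<partial>g*(p)\<close>; pairing it with a subgradient of
  \<open>g\<close> at \<open>(u - p) / \<alpha>\<close> replaces the biconjugate theorem.\<close>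

lemma prox_conjugate_subgradient:
  fixes g :: "'a::euclidean_space \<Rightarrow> real"
  assumes "convex_on UNIV g" "\<alpha> > 0"
    and p: "p \<in> prox_on UNIV (\<lambda>v. ereal \<alpha> * conjugate g v) u"
  shows "p \<in> subdifferential g ((u - p) /\<^sub>R \<alpha>)"
proof -
  let ?w = "(u - p) /\<^sub>R \<alpha>"
  obtain v where v: "v \<in> subdifferential g ?w"
    using subdifferential_nonempty[OF assms(1)] by blast
  define b where "b = ?w \<bullet> v - g ?w"
  have conj_v: "conjugate g v = ereal b"
    using conjugate_subgradient[OF v] by (simp add: b_def)
  have min: "ereal \<alpha> * conjugate g p + ereal (1/2 * (norm (p - u))\<^sup>2)
      \<le> ereal \<alpha> * conjugate g z + ereal (1/2 * (norm (z - u))\<^sup>2)" for z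
    using p by (simp add: prox_on_def is_arg_min_linorder)
  have "conjugate g p \<noteq> \<infinity>"
    using min[of v] conj_v \<open>\<alpha> > 0\<close> by auto
  then obtain a where conj_p: "conjugate g p = ereal a"
    using conjugate_not_MInf by (cases "conjugate g p") auto
  let ?d = "v - p"
  \<comment> \<open>Minimality of \<open>p\<close> against the point
    \<open>p + s *\<^sub>R (v - p)\<close>. Dividing by \<open>s\<close> and letting
    \<open>s\<close> tend to 0 leaves the variational inequality.\<close>
  have quad: "0 \<le> s * (\<alpha> * (b - a) + ?d \<bullet> (p - u) + s / 2 * (norm ?d)\<^sup>2)"
    if s: "0 \<le> s" "s \<le> 1" for s
  proof -
    have "ereal \<alpha> * ereal a + ereal (1/2 * (norm (p - u))\<^sup>2)
        \<le> ereal \<alpha> * ereal (a + s * (b - a)) + ereal (1/2 * (norm (p + s *\<^sub>R ?d - u))\<^sup>2)"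
      using min[of "p + s *\<^sub>R ?d"] conjugate_convex[OF conj_p conj_v s] \<open>\<alpha> > 0\<close>
      unfolding conj_p
      by (elim order_trans) (intro add_right_mono ereal_mult_left_mono, auto)
    then have "\<alpha> * a + 1/2 * (norm (p - u))\<^sup>2
        \<le> \<alpha> * (a + s * (b - a)) + 1/2 * (norm ((p - u) + s *\<^sub>R ?d))\<^sup>2"
      by (simp add: algebra_simps)
    then show ?thesis
      unfolding power2_norm_eq_inner
      by (simp add: inner_add_left inner_add_right inner_commute algebra_simps power2_eq_square)
  qed
  have "0 \<le> \<alpha> * (b - a) + ?d \<bullet> (p - u)"
  proof (rule field_le_epsilon)
    fix e :: real assume "e > 0"
    define D where "D = (norm ?d)\<^sup>2 / 2"
    \<comment> \<open>Chosen so that \<open>s * D \<le> e\<close>; the summand 1 avoids division by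
      zero when \<open>v = p\<close>.\<close>
    define s where "s = min 1 (e / (D + 1))"
    have "D \<ge> 0" by (simp add: D_def)
    then have s: "0 < s" "s \<le> 1" "s \<le> e / (D + 1)"
      using \<open>e > 0\<close> by (auto simp: s_def intro!: divide_pos_pos)
    have "s * D \<le> e / (D + 1) * D" using s \<open>D \<ge> 0\<close> by (intro mult_right_mono) auto
    also have "\<dots> \<le> e" using \<open>e > 0\<close> \<open>D \<ge> 0\<close> by (simp add: field_simps)
    finally have "s / 2 * (norm ?d)\<^sup>2 \<le> e" by (simp add: D_def)
    moreover have "0 \<le> \<alpha> * (b - a) + ?d \<bullet> (p - u) + s / 2 * (norm ?d)\<^sup>2"
      using quad[of s] s by (simp add: zero_le_mult_iff)
    ultimately show "0 \<le> \<alpha> * (b - a) + ?d \<bullet> (p - u) + e" by linarith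
  qed
  moreover have "?d \<bullet> (p - u) = \<alpha> * (?w \<bullet> p - ?w \<bullet> v)"
  proof -
    have w: "\<alpha> * (?w \<bullet> z) = u \<bullet> z - p \<bullet> z" for z
      using \<open>\<alpha> > 0\<close> by (simp add: inner_diff_left)
    show ?thesis
      unfolding right_diff_distrib w by (simp add: inner_diff_left inner_diff_right inner_commute)
  qed
  ultimately have "0 \<le> \<alpha> * (b - a) + \<alpha> * (?w \<bullet> p - ?w \<bullet> v)" by simp
  then have "0 \<le> \<alpha> * (b - a - ?w \<bullet> v + ?w \<bullet> p)" by (simp only: algebra_simps)
  \<comment> \<open>The definition of \<open>b\<close> cancels the terms in \<open>v\<close>,
    leaving the reverse Fenchel-Young inequality for \<open>p\<close> at
    \<open>(u - p) /\<^sub>R \<alpha>\<close>.\<close>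
  then have "a \<le> ?w \<bullet> p - g ?w"
    using \<open>\<alpha> > 0\<close> by (simp add: zero_le_mult_iff b_def)
  then show ?thesis
    by (intro subgradientI_conjugate) (simp only: conj_p ereal_less_eq)
qed

text \<open>The direct method: the quadratic term outgrows the constant lower bound, so a minimising
  sequence is eventually bounded, and lower semicontinuity makes a limit of a subsequence a
  minimiser.\<close>

lemma prox_on_nonempty:
  fixes S :: "'a::euclidean_space set" and \<phi> :: "'a \<Rightarrow> ereal"
  assumes "closed S" "proper_on S \<phi>" "lsc_on S \<phi>" and m: "\<And>z. z \<in> S \<Longrightarrow> ereal m \<le> \<phi> z"
    and "\<alpha> > 0"
  shows "prox_on S (\<lambda>z. ereal \<alpha> * \<phi> z) u \<noteq> {}"
proof -
  define \<psi> where "\<psi> z = ereal \<alpha> * \<phi> z + ereal (1/2 * (norm (z - u))\<^sup>2)" for z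
  obtain z0 where z0: "z0 \<in> S" "\<phi> z0 < \<infinity>" using assms(2) by (auto simp: proper_on_def)
  have lower: "ereal (\<alpha> * m + 1/2 * (norm (z - u))\<^sup>2) \<le> \<psi> z" if "z \<in> S" for z
  proof -
    have "ereal \<alpha> * ereal m \<le> ereal \<alpha> * \<phi> z"
      using m[OF that] \<open>\<alpha> > 0\<close> by (intro ereal_mult_left_mono) auto
    from add_right_mono[OF this, of "ereal (1/2 * (norm (z - u))\<^sup>2)"]
    show ?thesis unfolding \<psi>_def by simp
  qed
  have "ereal (\<alpha> * m) \<le> Inf (\<psi> ` S)"
  proof (rule INF_greatest)
    fix z assume "z \<in> S"
    have "ereal (\<alpha> * m) \<le> ereal (\<alpha> * m + 1/2 * (norm (z - u))\<^sup>2)" by simp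
    also note lower[OF \<open>z \<in> S\<close>]
    finally show "ereal (\<alpha> * m) \<le> \<psi> z" .
  qed
  moreover have "\<psi> z0 < \<infinity>"
    using z0(2) m[OF z0(1)] \<open>\<alpha> > 0\<close> by (cases "\<phi> z0") (auto simp: \<psi>_def)
  then have "Inf (\<psi> ` S) < \<infinity>"
    using INF_lower[OF z0(1), of \<psi>] by (rule le_less_trans[rotated])
  ultimately obtain I where I: "Inf (\<psi> ` S) = ereal I" by (cases "Inf (\<psi> ` S)") auto
  obtain w where "\<And>n. w n \<in> \<psi> ` S" and w: "w \<longlonglongrightarrow> ereal I"
    using Inf_as_limit[of "\<psi> ` S"] z0 I by auto
  then have "\<forall>n. \<exists>z. z \<in> S \<and> w n = \<psi> z" by blast
  then obtain z where z: "\<And>n. z n \<in> S" "\<And>n. w n = \<psi> (z n)" by metis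
  have "\<forall>\<^sub>F n in sequentially. \<psi> (z n) < ereal (I + 1)"
    using order_tendstoD(2)[OF w, of "ereal (I + 1)"] by (simp add: z(2))
  then obtain n0 where n0: "\<And>n. n \<ge> n0 \<Longrightarrow> \<psi> (z n) < ereal (I + 1)"
    by (auto simp: eventually_sequentially)
  \<comment> \<open>By \<open>lower\<close>, every point of \<open>S\<close> with objective below
    \<open>I + 1\<close> lies within \<open>R\<close> of \<open>u\<close>; the absolute value spares
    a sign argument.\<close>
  define R where "R = sqrt (2 * \<bar>I + 1 - \<alpha> * m\<bar>)"
  have "z (n + n0) \<in> S \<inter> cball u R" for n
  proof -
    have "\<alpha> * m + 1/2 * (norm (z (n + n0) - u))\<^sup>2 < I + 1"
      using le_less_trans[OF lower[OF z(1)] n0, of "n + n0"] by simp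
    then have "(norm (z (n + n0) - u))\<^sup>2 \<le> 2 * \<bar>I + 1 - \<alpha> * m\<bar>" by (simp add: abs_if)
    then have "norm (z (n + n0) - u) \<le> R" unfolding R_def by (rule real_le_rsqrt)
    then show ?thesis using z(1) by (simp add: dist_norm norm_minus_commute)
  qed
  moreover have "compact (S \<inter> cball u R)"
    using \<open>closed S\<close> by (simp add: closed_Int_compact)
  ultimately obtain p r where p: "p \<in> S \<inter> cball u R" and r: "strict_mono r"
      and "((\<lambda>n. z (n + n0)) \<circ> r) \<longlonglongrightarrow> p"
    unfolding compact_def by metis
  then have lim: "(\<lambda>n. z (r n + n0)) \<longlonglongrightarrow> p" by (simp add: comp_def)
  have "filterlim (\<lambda>n. r n + n0) sequentially sequentially"
    using filterlim_compose[OF filterlim_add_const_nat_at_top filterlim_subseq[OF r]] .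
  then have wlim: "(\<lambda>n. \<psi> (z (r n + n0))) \<longlonglongrightarrow> ereal I"
    using filterlim_compose[OF w] by (simp add: z(2))
  have "\<psi> p \<le> ereal I"
  proof (rule ccontr)
    assume "\<not> \<psi> p \<le> ereal I"
    then have gt: "ereal I < \<psi> p" by simp
    define N where "N = 1/2 * (norm (p - u))\<^sup>2"
    have "ereal ((I - N) / \<alpha>) < \<phi> p"
      using gt \<open>\<alpha> > 0\<close> m p by (cases "\<phi> p") (auto simp: \<psi>_def N_def field_simps)
    \<comment> \<open>Lower semicontinuity keeps \<open>\<phi>\<close> above \<open>c\<close> near
      \<open>p\<close>, so the objective values along the subsequence have a limit of at least
      \<open>\<alpha> * c + N\<close>, which exceeds \<open>I\<close>.\<close>
    then obtain c where c: "ereal ((I - N) / \<alpha>) < ereal c" "ereal c < \<phi> p"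
      using ereal_dense2 by blast
    have "\<phi> p \<le> Liminf (at p within S) \<phi>" using assms(3) p by (auto simp: lsc_on_def)
    then have "\<forall>\<^sub>F x in at p within S. ereal c < \<phi> x" using c(2) by (auto simp: le_Liminf_iff)
    \<comment> \<open>The filter \<open>at p within S\<close> ignores \<open>p\<close> itself, but
      the sequence may hit \<open>p\<close>; there the bound is the choice of
      \<open>c\<close>.\<close>
    then have "\<forall>\<^sub>F x in nhds p. x \<in> S \<longrightarrow> ereal c < \<phi> x"
      unfolding eventually_at_filter by eventually_elim (use c(2) in auto)
    then have "\<forall>\<^sub>F n in sequentially. ereal c < \<phi> (z (r n + n0))"
      using lim z(1) unfolding filterlim_iff by auto
    then have "\<forall>\<^sub>F n in sequentially.
        ereal (\<alpha> * c + 1/2 * (norm (z (r n + n0) - u))\<^sup>2) \<le> \<psi> (z (r n + n0))"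
    proof eventually_elim
      case (elim n)
      then have "ereal \<alpha> * ereal c \<le> ereal \<alpha> * \<phi> (z (r n + n0))"
        using \<open>\<alpha> > 0\<close> by (intro ereal_mult_left_mono) auto
      from add_right_mono[OF this, of "ereal (1/2 * (norm (z (r n + n0) - u))\<^sup>2)"]
      show ?case unfolding \<psi>_def by simp
    qed
    moreover have "(\<lambda>n. ereal (\<alpha> * c + 1/2 * (norm (z (r n + n0) - u))\<^sup>2)) \<longlonglongrightarrow> ereal (\<alpha> * c + N)"
      unfolding N_def lim_ereal by (intro tendsto_intros lim)
    ultimately have "ereal (\<alpha> * c + N) \<le> ereal I"
      using tendsto_le[OF sequentially_bot wlim] by blast
    then show False using c(1) \<open>\<alpha> > 0\<close> by (simp add: field_simps)
  qed
  then have "\<psi> p \<le> \<psi> x" if "x \<in> S" for x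
    using INF_lower[OF that, of \<psi>] I by (metis order_trans)
  then have "p \<in> prox_on S (\<lambda>z. ereal \<alpha> * \<phi> z) u"
    using p by (simp add: prox_on_def is_arg_min_linorder \<psi>_def)
  then show ?thesis by blast
qed

lemma closed_block_space: "closed (block_space blk i)"
proof -
  have "block_space blk i = (\<Inter>j\<in>{j. blk j \<noteq> i}. {z. z $ j = 0})"
    by (auto simp: block_space_def)
  also have "closed \<dots>"
    by (intro closed_INT ballI closed_Collect_eq continuous_intros)
  finally show ?thesis .
qed

section \<open>The reference value\<close>

text \<open>The index set in \<open>last_max_index\<close> contains indices before the window too,
  but all its members share the maximal value over the window. Only this value matters
  afterwards.\<close>

lemma Q_ref_eq_Max: "Q_ref f g h M xs ys t = Max ((\<lambda>s. Q_fun f g h (xs s) (ys s)) ` {t - M..t})"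
proof -
  define q where "q s = Q_fun f g h (xs s) (ys s)" for s
  let ?J = "{j. j \<le> t \<and> q j = Max (q ` {t - M..t})}"
  have "Max (q ` {t - M..t}) \<in> q ` {t - M..t}" by (intro Max_in) auto
  then obtain j where "j \<in> {t - M..t}" "q j = Max (q ` {t - M..t})" by (metis imageE)
  then have "j \<in> ?J" by simp
  then have "?J \<noteq> {}" by blast
  moreover have "finite ?J" by simp
  ultimately have "Max ?J \<in> ?J" by (intro Max_in)
  then show ?thesis by (simp add: Q_ref_def Let_def last_max_index_def q_def)
qed

lemma Q_fun_le_Q_ref: "Q_fun f g h (xs t) (ys t) \<le> Q_ref f g h M xs ys t"
  unfolding Q_ref_eq_Max by (intro Max_ge) auto

lemma Q_ref_0: "Q_ref f g h M xs ys 0 = Q_fun f g h (xs 0) (ys 0)"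
  unfolding Q_ref_eq_Max by simp

text \<open>When the window moves, \<open>Suc t\<close> is its only new index, so bounding the new
  value of \<open>Q\<close> by the old maximum suffices.\<close>

lemma Q_ref_Suc_le:
  assumes "Q_fun f g h (xs (Suc t)) (ys (Suc t)) \<le> Q_ref f g h M xs ys t"
  shows "Q_ref f g h M xs ys (Suc t) \<le> Q_ref f g h M xs ys t"
  unfolding Q_ref_eq_Max[of _ _ _ _ _ _ "Suc t"]
proof (intro Max.boundedI)
  fix a assume "a \<in> (\<lambda>s. Q_fun f g h (xs s) (ys s)) ` {Suc t - M..Suc t}"
  then obtain s where s: "s \<in> {Suc t - M..Suc t}" "a = Q_fun f g h (xs s) (ys s)" by blast
  show "a \<le> Q_ref f g h M xs ys t"
  proof (cases "s = Suc t")
    case False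
    then have "s \<in> {t - M..t}" using s by auto
    then show ?thesis unfolding Q_ref_eq_Max s(2) by (intro Max_ge) auto
  qed (use assms s in simp)
qed auto

section \<open>One iteration\<close>

text \<open>Clears the denominator, which is positive and finite, to match the form of the
  line-search test.\<close>

lemma Q_fun_le_iff:
  assumes "x \<in> dom f" "y \<in> dom (conjugate g)" "eta g x y > 0"
  shows "Q_fun f g h x y \<le> c \<longleftrightarrow> zeta f h x \<le> c * eta g x y"
proof -
  have "eta g x y \<noteq> \<infinity>" using eta_le[of g x y] by auto
  then show ?thesis
    using assms by (simp add: Q_fun_def ereal_divide_le_pos mult.commute)
qed

text \<open>A nonnegative numerator is divided by \<open>eta\<close>, which is positive and at most
  \<open>g\<close>. This turns bounds on \<open>Q\<close> into membership in the level set.\<close>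

lemma F_fun_le_Q_fun:
  assumes "0 \<le> zeta f h x"
  shows "F_fun f g h x \<le> Q_fun f g h x y"
proof (cases "x \<in> dom f \<and> y \<in> dom (conjugate g) \<and> eta g x y > 0")
  case True
  then obtain e where e: "eta g x y = ereal e" "0 < e" "e \<le> g x"
    using eta_le[of g x y] by (cases "eta g x y") auto
  then have "zeta f h x / ereal (g x) \<le> zeta f h x / ereal e"
    using assms by (cases "zeta f h x") (auto intro: divide_left_mono)
  then show ?thesis
    using True e by (auto simp: F_fun_def Q_fun_def Omega_def)
qed (auto simp: Q_fun_def)

lemma Q_fun_nonneg:
  assumes "\<forall>x\<in>dom f. 0 \<le> zeta f h x"
  shows "0 \<le> Q_fun f g h x y"
  using assms by (auto simp: Q_fun_def)

text \<open>Here \<open>eta\<close> equals \<open>g\<close> by the equality case of Fenchel-Young;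
  this starts the invariant at \<open>(x0, y0)\<close>.\<close>

lemma Q_fun_subgradient:
  assumes "x \<in> dom (F_fun f g h)" "y \<in> subdifferential g x" "0 \<le> g x"
  shows "0 < eta g x y" "Q_fun f g h x y = F_fun f g h x"
proof -
  have x: "x \<in> Omega g" "x \<in> dom f"
    using assms(1) by (auto simp: dom_def F_fun_def split: if_splits)
  have eta: "eta g x y = ereal (g x)"
    by (simp add: eta_def conjugate_subgradient[OF assms(2)])
  show "0 < eta g x y" using x(1) assms(3) by (simp add: eta Omega_def)
  then show "Q_fun f g h x y = F_fun f g h x"
    using x conjugate_subgradient[OF assms(2)] by (simp add: Q_fun_def F_fun_def eta dom_def)
qed

text \<open>With \<open>w = x + (y - y') /\<^sub>R \<alpha>\<close>, subtract the equality case of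
  Fenchel-Young for \<open>(w, y')\<close> from the inequality for \<open>(w, y)\<close>. The gain
  in \<open>eta\<close> is at least \<open>(w - x) \<bullet> (y - y')\<close>.\<close>

lemma step_Y_progress:
  fixes g :: "'a::euclidean_space \<Rightarrow> real"
  assumes "convex_on UNIV g" "\<alpha> > 0" "step_Y g \<alpha> x y x' y'"
  shows "y' \<in> subdifferential g (x + (y - y') /\<^sub>R \<alpha>)"
    and "eta g x y + ereal ((norm (y' - y))\<^sup>2 / \<alpha>) \<le> eta g x y'"
proof -
  let ?w = "(y + \<alpha> *\<^sub>R x - y') /\<^sub>R \<alpha>"
  have w: "?w = x + (y - y') /\<^sub>R \<alpha>"
    using \<open>\<alpha> > 0\<close> by (simp add: algebra_simps)
  show sub: "y' \<in> subdifferential g (x + (y - y') /\<^sub>R \<alpha>)"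
    using prox_conjugate_subgradient[OF assms(1,2), of y' "y + \<alpha> *\<^sub>R x"] assms(3)
    by (simp add: step_Y_def w)
  let ?k = "(x + (y - y') /\<^sub>R \<alpha>) \<bullet> y' - g (x + (y - y') /\<^sub>R \<alpha>)"
  have eta': "eta g x y' = ereal (x \<bullet> y' - ?k)"
    unfolding eta_def conjugate_subgradient[OF sub] by simp
  show "eta g x y + ereal ((norm (y' - y))\<^sup>2 / \<alpha>) \<le> eta g x y'"
  proof (cases "conjugate g y")
    case (real b)
    have "(x + (y - y') /\<^sub>R \<alpha>) \<bullet> y - g (x + (y - y') /\<^sub>R \<alpha>) \<le> b"
      using conjugate_ge[of "x + (y - y') /\<^sub>R \<alpha>" y g] real by simp
    moreover have "((y - y') /\<^sub>R \<alpha>) \<bullet> (y - y') = (norm (y' - y))\<^sup>2 / \<alpha>"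
      by (simp add: power2_norm_eq_inner inner_diff_left inner_diff_right divide_inverse_commute
          inner_commute algebra_simps)
    ultimately have "x \<bullet> y - b + (norm (y' - y))\<^sup>2 / \<alpha> \<le> x \<bullet> y' - ?k"
      unfolding inner_add_left inner_diff_right by linarith
    then show ?thesis unfolding eta' by (simp add: eta_def real)
  qed (auto simp: eta_def)
qed

text \<open>If \<open>\<eta>(x', y) \<le> 0\<close>, the quadratic term of the test forces \<open>x' = x\<close>, contradicting
  \<open>\<eta>(x, y) > 0\<close>.\<close>

lemma accepted_progress:
  assumes fin: "\<And>x. f x \<noteq> -\<infinity>" "\<And>x. h x \<noteq> -\<infinity>"
    and nonneg: "\<forall>x\<in>dom f. 0 \<le> zeta f h x"
    and "y \<in> dom (conjugate g)" "0 < eta g x y" "0 < \<sigma>" "0 \<le> q"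
    and acc: "accepted f g h \<sigma> (ereal q) x y x'"
  shows "x' \<in> dom f" "0 < eta g x' y"
proof -
  obtain k where k: "conjugate g y = ereal k"
    using \<open>y \<in> dom (conjugate g)\<close> by (cases "conjugate g y") (auto simp: dom_def)
  have eta: "eta g z y = ereal (z \<bullet> y - k)" for z by (simp add: eta_def k)
  have le: "zeta f h x' + ereal (\<sigma> / 2 * (norm (x' - x))\<^sup>2) \<le> ereal (q * (x' \<bullet> y - k))"
    using acc by (simp add: accepted_def eta)
  \<comment> \<open>The right-hand side of the test is a real number because the conjugate is finite
    at \<open>y\<close>.\<close>
  then have "f x' < \<infinity>"
    using fin[of x'] by (cases "f x'"; cases "h x'") (auto simp: zeta_def)
  then show "x' \<in> dom f" by (simp add: dom_def)
  with nonneg le obtain z where "zeta f h x' = ereal z" "0 \<le> z"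
    by (cases "zeta f h x'") auto
  with le have real: "\<sigma> / 2 * (norm (x' - x))\<^sup>2 \<le> q * (x' \<bullet> y - k)" by simp
  show "0 < eta g x' y"
  proof (rule ccontr)
    assume "\<not> 0 < eta g x' y"
    then have "q * (x' \<bullet> y - k) \<le> 0" using \<open>0 \<le> q\<close> by (simp add: eta mult_nonneg_nonpos)
    with real have "\<sigma> / 2 * (norm (x' - x))\<^sup>2 \<le> 0" by linarith
    then have "x' = x" using \<open>0 < \<sigma>\<close> by (simp add: mult_le_0_iff)
    with \<open>0 < eta g x y\<close> \<open>\<not> 0 < eta g x' y\<close> show False by simp
  qed
qed

text \<open>Either the initial step size is accepted, or the trial just before the last was rejected
  with a step size of at least \<open>\<alpha>S\<close>, and one more reduction costs a factor
  \<open>\<gamma>\<close>.\<close>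

lemma backtracking_lower_bound:
  fixes \<alpha>0 \<gamma> :: real
  assumes "\<alpha>lo \<le> \<alpha>0" "0 < \<alpha>lo" "0 < \<gamma>" "\<gamma> < 1"
    and small: "\<And>j. j < k \<Longrightarrow> \<alpha>S \<le> \<alpha>0 * \<gamma> ^ j"
  shows "\<gamma> * min \<alpha>lo \<alpha>S \<le> \<alpha>0 * \<gamma> ^ k"
proof (cases k)
  case 0
  have "\<gamma> * min \<alpha>lo \<alpha>S \<le> \<gamma> * \<alpha>lo" using assms by (intro mult_left_mono) auto
  also have "\<dots> \<le> \<alpha>lo" using assms by (simp add: mult_left_le_one_le)
  finally show ?thesis using 0 assms by simp
next
  case (Suc j)
  have "\<gamma> * min \<alpha>lo \<alpha>S \<le> \<gamma> * (\<alpha>0 * \<gamma> ^ j)"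
    using small[of j] Suc \<open>0 < \<gamma>\<close> by (intro mult_left_mono) (auto intro: min.coboundedI2)
  then show ?thesis using Suc by (simp add: ac_simps)
qed

section \<open>The invariant along runs of MPGA\<close>

theorem theorem4p6:
  fixes f h :: "real^'n \<Rightarrow> ereal" and g :: "real^'n \<Rightarrow> real"
    and blk :: "'n \<Rightarrow> nat" and N :: nat and fs :: "nat \<Rightarrow> real^'n \<Rightarrow> ereal"
    and x0 y0 :: "real^'n" and \<alpha>lo \<alpha>hi \<sigma> \<gamma> :: real and M :: nat
    and gbar \<alpha>S \<alpha>star C0 :: real
  assumes f: "proper_on UNIV f" "lsc_on UNIV f"
    and g: "lsc_on UNIV (\<lambda>x. ereal (g x))"
    and h: "proper_on UNIV h" "lsc_on UNIV h"
    and Omega: "Omega g \<noteq> {}"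
    and blocks: "range blk = {1..N}"
    and fs: "\<forall>i\<in>{1..N}. proper_on (block_space blk i) (fs i) \<and> lsc_on (block_space blk i) (fs i)"
    and separable: "\<forall>x. f x = (\<Sum>i=1..N. fs i (block blk i x))"
    and a: "continuous_on (dom f) f"
      "\<forall>i\<in>{1..N}. \<exists>m::real. \<forall>z\<in>block_space blk i. ereal m \<le> fs i z"
    and b: "loc_Lipschitz_differentiable_on (Omega g) h"
    and c: "convex_on UNIV g" "\<forall>x. g x \<ge> 0"
    and d: "\<forall>x\<in>dom f. f x + h x \<ge> 0"
    and x0: "x0 \<in> dom (F_fun f g h)"
    and y0: "y0 \<in> subdifferential g x0"
    and params: "0 < \<alpha>lo" "\<alpha>lo \<le> \<alpha>hi" "0 < \<sigma>" "0 < \<gamma>" "\<gamma> < 1"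
    and compact_X: "compact (X_set f g h x0)"
    and gbar: "0 < gbar" "\<forall>x\<in>X_set f g h x0. g x \<le> gbar"
    and \<alpha>S_pos: "0 < \<alpha>S"
    and \<alpha>S: "\<forall>(x, y)\<in>S_set f g h x0 gbar \<alpha>lo. Q_fun f g h x y \<le> F_fun f g h x0 \<longrightarrow>
      (\<forall>\<alpha>\<in>{0<..<\<alpha>S}. \<forall>i\<in>{1..N}. \<forall>c::real. Q_fun f g h x y \<le> ereal c \<longrightarrow>
        (\<forall>p\<in>trial_blocks blk fs f g h x y i \<alpha>.
          accepted f g h \<sigma> (ereal c) x y (replace_block blk i x p)))"
    and \<alpha>star: "\<alpha>star = \<gamma> * min \<alpha>lo \<alpha>S"
    and C0: "C0 = min (\<sigma> / 2) (1 / \<alpha>hi)"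
  shows
    "(\<forall>T xs ys ind al. mpga_run blk N fs f g h \<alpha>lo \<alpha>hi \<sigma> \<gamma> M x0 y0 T xs ys ind al \<longrightarrow>
        (\<forall>i\<in>{1..N}. \<forall>\<alpha>0\<in>{\<alpha>lo..\<alpha>hi}.
          (\<forall>k. trial_blocks blk fs f g h (xs T) (ys T) i (\<alpha>0 * \<gamma> ^ k) \<noteq> {}) \<and>
          (\<forall>p. (\<forall>k. p k \<in> trial_blocks blk fs f g h (xs T) (ys T) i (\<alpha>0 * \<gamma> ^ k)) \<longrightarrow>
            (\<exists>k. stops_at blk f g h \<sigma> (Q_ref f g h M xs ys T) (xs T) (ys T) i p k \<and>
              \<alpha>0 * \<gamma> ^ k \<ge> \<alpha>star)))) \<and>
     0 < C0 \<and>
     (\<forall>xs ys ind al. (\<forall>T. mpga_run blk N fs f g h \<alpha>lo \<alpha>hi \<sigma> \<gamma> M x0 y0 T xs ys ind al) \<longrightarrow>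
        (\<forall>t. al t \<ge> \<alpha>star) \<and>
        (\<forall>t. (xs t, ys t) \<in> S_set f g h x0 gbar \<alpha>lo) \<and>
        (\<forall>t. zeta f h (xs (Suc t))
              + ereal C0 * (ereal ((norm (xs (Suc t) - xs t))\<^sup>2)
                  + Q_ref f g h M xs ys t * ereal ((norm (ys (Suc t) - ys t))\<^sup>2))
             \<le> Q_ref f g h M xs ys t * eta g (xs (Suc t)) (ys (Suc t))) \<and>
        (\<forall>t. Q_fun f g h (xs (Suc t)) (ys (Suc t)) \<le> Q_ref f g h M xs ys (Suc t) \<and>
             Q_ref f g h M xs ys (Suc t) \<le> Q_ref f g h M xs ys t \<and>
             Q_ref f g h M xs ys t \<le> F_fun f g h x0))"
proof -
  let ?F = "F_fun f g h" and ?Q = "Q_fun f g h" and ?S = "S_set f g h x0 gbar \<alpha>lo"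
  let ?Y = "Y_set g (X_set f g h x0) gbar \<alpha>lo"
  have fin: "f x \<noteq> -\<infinity>" "h x \<noteq> -\<infinity>" for x using f(1) h(1) by (auto simp: proper_on_def)
  have nonneg: "\<forall>x\<in>dom f. 0 \<le> zeta f h x" using d by (simp add: zeta_def)
  have "0 < \<alpha>hi" using params by simp
  have F0: "?F x0 < \<infinity>" using x0 by (simp add: dom_def)
  \<comment> \<open>The bound by \<open>\<sigma> / 2\<close> serves Step 2-X, the bound by
    \<open>1 / \<alpha>hi\<close> Step 2-Y.\<close>
  have C0_pos: "0 < C0" and C0_le: "C0 \<le> \<sigma> / 2" "C0 \<le> 1 / \<alpha>hi"
    using params \<open>0 < \<alpha>hi\<close> by (auto simp: C0)
  have S_D: "x \<in> dom f" "g x \<le> gbar" "y \<in> dom (conjugate g)" "0 < eta g x y" "x \<in> X_set f g h x0"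
    if S: "(x, y) \<in> ?S" for x y
  proof -
    show x: "x \<in> X_set f g h x0" and "0 < eta g x y" using S by (auto simp: S_set_def)
    \<comment> \<open>Finiteness of \<open>F\<close> at \<open>x0\<close> keeps the level set away
      from the points where \<open>F\<close> takes the value \<infinity>.\<close>
    then have "?F x < \<infinity>" using F0 by (auto simp: X_set_def)
    then show "x \<in> dom f" by (auto simp: F_fun_def split: if_splits)
    show "g x \<le> gbar" using gbar x by blast
    obtain z where "y \<in> subdifferential g z" using S by (auto simp: S_set_def Y_set_def)
    then show "y \<in> dom (conjugate g)" by (simp add: dom_def conjugate_subgradient)
  qed
  have S_I: "(x, y) \<in> ?S"
    if "x \<in> dom f" "y \<in> ?Y" "0 < eta g x y" "?Q x y \<le> ?F x0" for x y
  proof -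
    have "?F x \<le> ?F x0" using F_fun_le_Q_fun[of f h x g y] nonneg that by (auto intro: order_trans)
    then show ?thesis using that by (simp add: S_set_def X_set_def)
  qed
  \<comment> \<open>The contrapositive of the property of \<open>\<alpha>S\<close>, with a real
    reference value in place of the bound on \<open>Q\<close>.\<close>
  have small: "\<alpha>S \<le> \<alpha>"
    if "(x, y) \<in> ?S" "?Q x y \<le> ereal q" "ereal q \<le> ?F x0" "i \<in> {1..N}" "0 < \<alpha>"
      "p \<in> trial_blocks blk fs f g h x y i \<alpha>"
      "\<not> accepted f g h \<sigma> (ereal q) x y (replace_block blk i x p)" for x y q i \<alpha> p
  proof (rule ccontr)
    assume "\<not> \<alpha>S \<le> \<alpha>"
    moreover have "?Q x y \<le> ?F x0" using that(2,3) by (rule order_trans)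
    ultimately show False using \<alpha>S that by fastforce
  qed
  \<comment> \<open>A reference value lies between 0 and the finite \<open>F\<close> value at
    \<open>x0\<close>, so it can be handled as a nonnegative real.\<close>
  have real_ref: "\<exists>q. c = ereal q \<and> 0 \<le> q" if "?Q x y \<le> c" "c \<le> ?F x0" for x y c
    using order_trans[OF Q_fun_nonneg[OF nonneg] that(1)] that(2) F0 by (cases c) auto
  \<comment> \<open>The reference value is abstracted to any \<open>c\<close> between
    \<open>?Q x y\<close> and \<open>?F x0\<close>, so a single step can be treated without its
    history.\<close>
  have iteration: "\<alpha>star \<le> \<alpha> \<and> (x', y') \<in> ?S \<and> ?Q x' y' \<le> c \<and>
      zeta f h x' + ereal C0 * (ereal ((norm (x' - x))\<^sup>2) + c * ereal ((norm (y' - y))\<^sup>2))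
        \<le> c * eta g x' y'"
    if S: "(x, y) \<in> ?S" and Q: "?Q x y \<le> c" and c_le: "c \<le> ?F x0" and "i \<in> {0..N}"
      and \<alpha>0: "\<alpha>0 \<in> {\<alpha>lo..\<alpha>hi}"
      and update: "if i = 0 then \<alpha> = \<alpha>0 \<and> step_Y g \<alpha>0 x y x' y'
        else step_X blk fs f g h \<sigma> \<gamma> c i \<alpha>0 x y \<alpha> x' y'" for x y c i \<alpha>0 \<alpha> x' y'
  proof -
    note x = S_D[OF S]
    obtain q where q: "c = ereal q" "0 \<le> q" using real_ref[OF Q c_le] by blast
    have "0 < \<alpha>0" using \<alpha>0 params by simp
    obtain k where k: "conjugate g y = ereal k"
      using x(3) by (cases "conjugate g y") (auto simp: dom_def)
    have zeta_le: "zeta f h x \<le> c * eta g x y"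
      using Q Q_fun_le_iff[OF x(1,3,4)] by blast
    show ?thesis
    proof (cases "i = 0")
      case True
      then have upd: "\<alpha> = \<alpha>0" "step_Y g \<alpha>0 x y x' y'" using update by auto
      have [simp]: "x' = x" using upd(2) by (simp add: step_Y_def)
      define w where "w = x + (y - y') /\<^sub>R \<alpha>0"
      define n where "n = (norm (y' - y))\<^sup>2"
      have sub: "y' \<in> subdifferential g w"
        and inc: "eta g x y + ereal (n / \<alpha>0) \<le> eta g x y'"
        using step_Y_progress[OF c(1) \<open>0 < \<alpha>0\<close> upd(2)] by (simp_all add: w_def n_def)
      have "0 \<le> n" by (simp add: n_def)
      obtain k' where k': "conjugate g y' = ereal k'" using conjugate_subgradient[OF sub] by simp
      have eta: "eta g x y = ereal (x \<bullet> y - k)" "eta g x y' = ereal (x \<bullet> y' - k')"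
        by (simp_all add: eta_def k k')
      have le: "x \<bullet> y - k + n / \<alpha>0 \<le> x \<bullet> y' - k'" and pos: "0 < x \<bullet> y - k"
        using inc x(4) by (simp_all add: eta)
      have pos': "0 < eta g x y'"
        using le pos \<open>0 \<le> n\<close> \<open>0 < \<alpha>0\<close> by (simp add: eta) (smt (verit) divide_nonneg_pos)
      have "y' \<in> ?Y"
      proof -
        \<comment> \<open>Since \<open>eta g x y > 0\<close>, the gain \<open>n / \<alpha>0\<close>
          is below \<open>eta g x y' \<le> g x \<le> gbar\<close>. Dividing once more by
          \<open>\<alpha>0 \<ge> \<alpha>lo\<close> bounds the squared distance from
          \<open>w\<close> to \<open>x\<close>.\<close>
        have "n / \<alpha>0 \<le> gbar" using le pos eta_le[of g x y'] x(2) by (simp add: eta)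
        then have "n / \<alpha>0 / \<alpha>0 \<le> gbar / \<alpha>lo"
          using \<alpha>0 params gbar(1) \<open>0 \<le> n\<close> by (intro frac_le) auto
        moreover have "(infdist w (X_set f g h x0))\<^sup>2 \<le> (dist w x)\<^sup>2"
          using x(5) by (intro power_mono infdist_le infdist_nonneg)
        moreover have "(dist w x)\<^sup>2 = n / \<alpha>0 / \<alpha>0"
          using \<open>0 < \<alpha>0\<close> by (simp add: w_def n_def dist_norm norm_minus_commute power_mult_distrib
              power2_eq_square divide_inverse)
        ultimately have "(infdist w (X_set f g h x0))\<^sup>2 \<le> gbar / \<alpha>lo" by linarith
        then show ?thesis using sub by (auto simp: Y_set_def)
      qed
      have y': "y' \<in> dom (conjugate g)" by (simp add: dom_def k')
      have "zeta f h x + ereal (C0 * (q * n)) \<le> ereal (q * (x \<bullet> y - k)) + ereal (C0 * (q * n))"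
        using zeta_le by (intro add_right_mono) (simp add: q eta)
      also have "\<dots> \<le> ereal (q * (x \<bullet> y' - k'))"
      proof -
        have "C0 * n \<le> n / \<alpha>0"
        proof -
          have "C0 \<le> 1 / \<alpha>0" using C0_le(2) \<alpha>0 \<open>0 < \<alpha>0\<close> by (auto elim!: order_trans intro!: frac_le)
          from mult_right_mono[OF this \<open>0 \<le> n\<close>] show ?thesis by simp
        qed
        then have "x \<bullet> y - k + C0 * n \<le> x \<bullet> y' - k'" using le by linarith
        from mult_left_mono[OF this q(2)] show ?thesis by (simp add: algebra_simps)
      qed
      finally have dec: "zeta f h x + ereal (C0 * (q * n)) \<le> c * eta g x y'" by (simp add: q eta)
      have "zeta f h x \<le> zeta f h x + ereal (C0 * (q * n))"
        using C0_pos q \<open>0 \<le> n\<close> by (simp add: ereal_le_add_self)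
      then have "?Q x y' \<le> c"
        using dec Q_fun_le_iff[OF x(1) y' pos'] by (auto intro: order_trans)
      moreover have "\<alpha>star \<le> \<alpha>"
        \<comment> \<open>Step 2-Y never shrinks the step size, so this is the case of zero
          rejections.\<close>
        using backtracking_lower_bound[of \<alpha>lo \<alpha>0 \<gamma> 0 \<alpha>S] \<alpha>0 params by (simp add: \<alpha>star upd)
      moreover have "(x, y') \<in> ?S"
        using S_I[OF x(1) \<open>y' \<in> ?Y\<close> pos'] \<open>?Q x y' \<le> c\<close> c_le by (auto intro: order_trans)
      ultimately show ?thesis using dec by (simp add: q n_def)
    next
      case False
      then have i: "i \<in> {1..N}" using \<open>i \<in> {0..N}\<close> by simp
      obtain p K where p: "\<forall>j\<le>K. p j \<in> trial_blocks blk fs f g h x y i (\<alpha>0 * \<gamma> ^ j)"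
        and stop: "stops_at blk f g h \<sigma> c x y i p K" and upd: "\<alpha> = \<alpha>0 * \<gamma> ^ K"
          "x' = replace_block blk i x (p K)" "y' = y"
        using update False by (auto simp: step_X_def)
      have acc: "accepted f g h \<sigma> (ereal q) x y x'" using stop by (simp add: stops_at_def upd q)
      have "\<alpha>S \<le> \<alpha>0 * \<gamma> ^ j" if "j < K" for j
        using small[of x y q i "\<alpha>0 * \<gamma> ^ j" "p j"] that p stop S Q c_le i \<open>0 < \<alpha>0\<close> params
        by (simp add: q stops_at_def)
      then have "\<alpha>star \<le> \<alpha>"
        using backtracking_lower_bound[of \<alpha>lo \<alpha>0 \<gamma> K \<alpha>S] \<alpha>0 params by (simp add: \<alpha>star upd)
      note x' = accepted_progress[OF fin nonneg x(3,4) params(3) q(2) acc]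
      have "zeta f h x' + ereal (C0 * (norm (x' - x))\<^sup>2)
          \<le> zeta f h x' + ereal (\<sigma> / 2 * (norm (x' - x))\<^sup>2)"
        using mult_right_mono[OF C0_le(1), of "(norm (x' - x))\<^sup>2"] by (intro add_left_mono) simp
      also have "\<dots> \<le> c * eta g x' y" using acc by (simp add: accepted_def q)
      finally have dec: "zeta f h x' + ereal (C0 * (norm (x' - x))\<^sup>2) \<le> c * eta g x' y" .
      have "zeta f h x' \<le> zeta f h x' + ereal (C0 * (norm (x' - x))\<^sup>2)"
        using C0_pos by (simp add: ereal_le_add_self)
      then have "?Q x' y \<le> c"
        using dec Q_fun_le_iff[OF x'(1) x(3) x'(2)] by (auto intro: order_trans)
      moreover have "y \<in> ?Y" using S by (simp add: S_set_def)
      ultimately have "(x', y) \<in> ?S"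
        using S_I[OF x'(1) _ x'(2)] c_le by (auto intro: order_trans)
      then show ?thesis using dec \<open>?Q x' y \<le> c\<close> \<open>\<alpha>star \<le> \<alpha>\<close> by (simp add: q upd(3))
    qed
  qed
  have init: "(x0, y0) \<in> ?S" "?Q x0 y0 = ?F x0"
  proof -
    note Q0 = Q_fun_subgradient[OF x0 y0 c(2)[rule_format]]
    show "?Q x0 y0 = ?F x0" by (rule Q0)
    have "x0 \<in> X_set f g h x0" by (simp add: X_set_def)
    \<comment> \<open>The witness is \<open>x0\<close> itself, at distance 0 from the level
      set.\<close>
    moreover have "y0 \<in> ?Y" using y0 \<open>x0 \<in> X_set f g h x0\<close> gbar(1) params(1)
      by (auto simp: Y_set_def intro!: exI[of _ x0])
    ultimately show "(x0, y0) \<in> ?S" using Q0(1) by (simp add: S_set_def)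
  qed
  have run_step: "\<alpha>star \<le> al t \<and> (xs (Suc t), ys (Suc t)) \<in> ?S \<and>
      ?Q (xs (Suc t)) (ys (Suc t)) \<le> Q_ref f g h M xs ys t \<and>
      zeta f h (xs (Suc t)) + ereal C0 * (ereal ((norm (xs (Suc t) - xs t))\<^sup>2)
          + Q_ref f g h M xs ys t * ereal ((norm (ys (Suc t) - ys t))\<^sup>2))
        \<le> Q_ref f g h M xs ys t * eta g (xs (Suc t)) (ys (Suc t))"
    if run: "mpga_run blk N fs f g h \<alpha>lo \<alpha>hi \<sigma> \<gamma> M x0 y0 T xs ys ind al" and "t < T"
      and inv: "(xs t, ys t) \<in> ?S" "Q_ref f g h M xs ys t \<le> ?F x0" for T xs ys ind al t
  proof -
    obtain \<alpha>0 where "ind t \<in> {0..N}" "\<alpha>0 \<in> {\<alpha>lo..\<alpha>hi}"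
      "if ind t = 0 then al t = \<alpha>0 \<and> step_Y g \<alpha>0 (xs t) (ys t) (xs (Suc t)) (ys (Suc t))
       else step_X blk fs f g h \<sigma> \<gamma> (Q_ref f g h M xs ys t) (ind t) \<alpha>0
                  (xs t) (ys t) (al t) (xs (Suc t)) (ys (Suc t))"
      using run \<open>t < T\<close> unfolding mpga_run_def by blast
    then show ?thesis by (rule iteration[OF inv(1) Q_fun_le_Q_ref inv(2)])
  qed
  \<comment> \<open>Stated for finite runs up to and including the last iterate, so that it is
    available before the next iteration is known to terminate.\<close>
  have run_inv: "(xs t, ys t) \<in> ?S \<and> Q_ref f g h M xs ys t \<le> ?F x0"
    if run: "mpga_run blk N fs f g h \<alpha>lo \<alpha>hi \<sigma> \<gamma> M x0 y0 T xs ys ind al" and "t \<le> T"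
    for T xs ys ind al t
    using \<open>t \<le> T\<close>
  proof (induction t)
    case 0
    then show ?case using run init by (simp add: mpga_run_def Q_ref_0)
  next
    case (Suc t)
    then have inv: "(xs t, ys t) \<in> ?S" "Q_ref f g h M xs ys t \<le> ?F x0" by auto
    note step = run_step[OF run _ inv]
    show ?case
      using step Suc.prems inv(2) Q_ref_Suc_le[of f g h xs t ys M] by (auto intro: order_trans)
  qed
  \<comment> \<open>Every trial can be carried out: the block function is bounded below and lower
    semicontinuous on a closed subspace.\<close>
  have nonempty: "trial_blocks blk fs f g h x y i \<alpha> \<noteq> {}" if "i \<in> {1..N}" "0 < \<alpha>" for x y i \<alpha>
    unfolding trial_blocks_def
    using that fs a(2) by (metis prox_on_nonempty closed_block_space)
  have stops: "\<exists>k. stops_at blk f g h \<sigma> (Q_ref f g h M xs ys T) (xs T) (ys T) i p k \<and>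
      \<alpha>star \<le> \<alpha>0 * \<gamma> ^ k"
    if run: "mpga_run blk N fs f g h \<alpha>lo \<alpha>hi \<sigma> \<gamma> M x0 y0 T xs ys ind al"
      and i: "i \<in> {1..N}" and \<alpha>0: "\<alpha>0 \<in> {\<alpha>lo..\<alpha>hi}"
      and p: "\<forall>k. p k \<in> trial_blocks blk fs f g h (xs T) (ys T) i (\<alpha>0 * \<gamma> ^ k)"
    for T xs ys ind al i \<alpha>0 p
  proof -
    let ?c = "Q_ref f g h M xs ys T"
    let ?acc = "\<lambda>k. accepted f g h \<sigma> ?c (xs T) (ys T) (replace_block blk i (xs T) (p k))"
    have inv: "(xs T, ys T) \<in> ?S" "?c \<le> ?F x0" using run_inv[OF run] by auto
    note Q = Q_fun_le_Q_ref[of f g h xs T ys M]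
    obtain q where q: "?c = ereal q" using real_ref[OF Q inv(2)] by blast
    have "0 < \<alpha>0" using \<alpha>0 params by simp
    have rejected: "\<alpha>S \<le> \<alpha>0 * \<gamma> ^ k" if "\<not> ?acc k" for k
      using small[of "xs T" "ys T" q i "\<alpha>0 * \<gamma> ^ k" "p k"] that inv Q p i \<open>0 < \<alpha>0\<close> params
      by (simp add: q)
    \<comment> \<open>The trial step sizes decrease geometrically, hence fall below
      \<open>\<alpha>S\<close>, where rejection is impossible. The least accepted trial is where the
      loop stops.\<close>
    obtain k where "\<gamma> ^ k < \<alpha>S / \<alpha>0"
      using real_arch_pow_inv[of "\<alpha>S / \<alpha>0" \<gamma>] \<alpha>S_pos \<open>0 < \<alpha>0\<close> params by auto
    then have "\<not> \<alpha>S \<le> \<alpha>0 * \<gamma> ^ k" using \<open>0 < \<alpha>0\<close> by (simp add: field_simps)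
    then have "?acc k" using rejected by blast
    define K where "K = (LEAST k. ?acc k)"
    have K: "?acc K" "\<And>j. j < K \<Longrightarrow> \<not> ?acc j"
      unfolding K_def using \<open>?acc k\<close> by (auto intro: LeastI dest: not_less_Least)
    then have "stops_at blk f g h \<sigma> ?c (xs T) (ys T) i p K" by (simp add: stops_at_def)
    moreover have "\<alpha>star \<le> \<alpha>0 * \<gamma> ^ K"
      unfolding \<alpha>star using \<alpha>0 params rejected K(2) by (intro backtracking_lower_bound) auto
    ultimately show ?thesis by blast
  qed
  show ?thesis
  proof (intro conjI allI impI ballI)
    fix T :: nat and xs ys ind al i and \<alpha>0 :: real and k :: nat
    assume "i \<in> {1..N}" "\<alpha>0 \<in> {\<alpha>lo..\<alpha>hi}"
    then show "trial_blocks blk fs f g h (xs T) (ys T) i (\<alpha>0 * \<gamma> ^ k) \<noteq> {}"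
      using params by (intro nonempty) auto
  next
    fix xs ys ind al t
    assume "\<forall>T. mpga_run blk N fs f g h \<alpha>lo \<alpha>hi \<sigma> \<gamma> M x0 y0 T xs ys ind al"
    then have run: "mpga_run blk N fs f g h \<alpha>lo \<alpha>hi \<sigma> \<gamma> M x0 y0 (Suc t) xs ys ind al" by blast
    have inv: "(xs t, ys t) \<in> ?S" "Q_ref f g h M xs ys t \<le> ?F x0"
      using run_inv[OF run, of t] by auto
    note step = run_step[OF run lessI inv]
    show "\<alpha>star \<le> al t" "(xs t, ys t) \<in> ?S" "Q_ref f g h M xs ys t \<le> ?F x0"
      "Q_fun f g h (xs (Suc t)) (ys (Suc t)) \<le> Q_ref f g h M xs ys (Suc t)"
      "zeta f h (xs (Suc t)) + ereal C0 * (ereal ((norm (xs (Suc t) - xs t))\<^sup>2)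
          + Q_ref f g h M xs ys t * ereal ((norm (ys (Suc t) - ys t))\<^sup>2))
        \<le> Q_ref f g h M xs ys t * eta g (xs (Suc t)) (ys (Suc t))"
      using step inv Q_fun_le_Q_ref by auto
    show "Q_ref f g h M xs ys (Suc t) \<le> Q_ref f g h M xs ys t"
      using step Q_ref_Suc_le by blast
  qed (use stops C0_pos in auto)
qed

end
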